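(* Let $O$ be a locally finite totally ordered set and $A\in\mathscr E_O$. An interval $I\in\mathscr I^\infty_O$ is critical for $A$ if and only if one of the following holds: (i) $I=[\ell+1..r'-1]\ne\emptyset$ where $[\ell..r],[\ell'..r']\in A$ and $[\ell'..r']$ is the successor of $[\ell..r]$ in $A$; (ii) $I=(\leftarrow..r-1]\ne\emptyset$ where $[\ell..r]$ is the first element of $A$ for some $\ell$; (iii) $I=[\ell+1..\rightarrow)\ne\emptyset$ where $[\ell..r]$ is the last element of $A$ for some $r$; (iv) $I=O$ and $A=0$; (v) $I=\emptyset$ and $A=1^-$.
   Context: $O=(O,\sqsubseteq)$ is locally finite and totally ordered. Intervals are convex subsets (including $\emptyset$); $\mathscr I_O$ = finite intervals, $\mathscr I^\infty_O$ = all intervals. $[\ell..r]=\{x:\ell\sqsubseteq x\sqsubseteq r\}$, $(\leftarrow..r]=\{x:x\sqsubseteq r\}$, $[\ell..\rightarrow)=\{x:\ell\sqsubseteq x\}$; $x+1$, $x-1$ are successor and predecessor in $O$, with the convention $[\ell+1..\rightarrow)=\emptyset$ if $\ell$ has no successor and $(\leftarrow..r-1]=\emptyset$ if $r$ has no predecessor. $\mathscr E_O$ is the set of inclusion-antichains of elements of $\mathscr I_O$, ordered by $A\le B$ iff for every $I\in A$ there is $J\in B$ with $J\subseteq I$; $0=\emptyset$, $1^-=\{\{x\}:x\in O\}$. The nonempty intervals of an antichain are totally ordered by their left extremes (equivalently right extremes); successor, first and last elements of $A$ refer to this order. An interval $I\in\mathscr I^\infty_O$ is critical for $A$ if it contains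 no interval of $A$ and is inclusion-maximal among the intervals of $\mathscr I^\infty_O$ containing no interval of $A$. *)

theory Defs
  imports Main
begin

text \<open>
  An ordered set is a carrier \<open>S\<close> with a relation \<open>R\<close> such that \<open>linear_order_on S R\<close>
  (which entails \<open>R \<subseteq> S \<times> S\<close>); the carrier may be empty. The rays are the library's
  \<open>under R u = {x. (x, u) \<in> R}\<close> and \<open>above R l = {x. (l, x) \<in> R}\<close>.
\<close>

definition closed_interval :: "'a rel \<Rightarrow> 'a \<Rightarrow> 'a \<Rightarrow> 'a set" where
  "closed_interval R l u = {x. (l, x) \<in> R \<and> (x, u) \<in> R}"

definition locally_finite :: "'a set \<Rightarrow> 'a rel \<Rightarrow> bool" where
  "locally_finite S R \<longleftrightarrow> (\<forall>l\<in>S. \<forall>u\<in>S. finite (closed_interval R l u))"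

definition intervals :: "'a set \<Rightarrow> 'a rel \<Rightarrow> 'a set set" where
  "intervals S R =
    {I. I \<subseteq> S \<and> (\<forall>x\<in>I. \<forall>z\<in>I. \<forall>y\<in>S. (x, y) \<in> R \<and> (y, z) \<in> R \<longrightarrow> y \<in> I)}"

definition finite_intervals :: "'a set \<Rightarrow> 'a rel \<Rightarrow> 'a set set" where
  "finite_intervals S R = {I \<in> intervals S R. finite I}"

definition interval_antichains :: "'a set \<Rightarrow> 'a rel \<Rightarrow> 'a set set set" where
  "interval_antichains S R =
    {A. A \<subseteq> finite_intervals S R \<and> (\<forall>I\<in>A. \<forall>J\<in>A. I \<subseteq> J \<longrightarrow> I = J)}"

definition singletons :: "'a set \<Rightarrow> 'a set set" where
  "singletons S = {{x} | x. x \<in> S}"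

definition is_successor :: "'b rel \<Rightarrow> 'b \<Rightarrow> 'b \<Rightarrow> bool" where
  "is_successor R x y \<longleftrightarrow>
    (x, y) \<in> R \<and> x \<noteq> y \<and> (\<forall>z. (x, z) \<in> R \<and> (z, y) \<in> R \<longrightarrow> z = x \<or> z = y)"

definition is_first :: "'b rel \<Rightarrow> 'b \<Rightarrow> bool" where
  "is_first R x \<longleftrightarrow> x \<in> Field R \<and> (\<forall>y\<in>Field R. (x, y) \<in> R)"

definition is_last :: "'b rel \<Rightarrow> 'b \<Rightarrow> bool" where
  "is_last R x \<longleftrightarrow> x \<in> Field R \<and> (\<forall>y\<in>Field R. (y, x) \<in> R)"

text \<open>
  The successor \<open>l + 1\<close> and the predecessor \<open>u - 1\<close> are partial. In a linear order each is unique
  if it exists, so the unions below have at most one member, and a missing successor or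
  predecessor yields \<open>{}\<close>. The three sets are \<open>[l + 1 .. \<rightarrow>)\<close>, \<open>(\<leftarrow> .. u - 1]\<close> and
  \<open>[l + 1 .. u - 1]\<close>.
\<close>

definition ray_from_succ :: "'a rel \<Rightarrow> 'a \<Rightarrow> 'a set" where
  "ray_from_succ R l = (\<Union>p\<in>{p. is_successor R l p}. above R p)"

definition ray_to_pred :: "'a rel \<Rightarrow> 'a \<Rightarrow> 'a set" where
  "ray_to_pred R u = (\<Union>q\<in>{q. is_successor R q u}. under R q)"

definition interval_succ_pred :: "'a rel \<Rightarrow> 'a \<Rightarrow> 'a \<Rightarrow> 'a set" where
  "interval_succ_pred R l u =
    (\<Union>p\<in>{p. is_successor R l p}. \<Union>q\<in>{q. is_successor R q u}. closed_interval R p q)"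

definition left_extreme :: "'a rel \<Rightarrow> 'a set \<Rightarrow> 'a" where
  "left_extreme R I = (THE l. l \<in> I \<and> (\<forall>x\<in>I. (l, x) \<in> R))"

definition antichain_order :: "'a rel \<Rightarrow> 'a set set \<Rightarrow> 'a set rel" where
  "antichain_order R A =
    {(I, J). I \<in> A - {{}} \<and> J \<in> A - {{}} \<and> (left_extreme R I, left_extreme R J) \<in> R}"

definition avoids :: "'a set set \<Rightarrow> 'a set \<Rightarrow> bool" where
  "avoids A I \<longleftrightarrow> \<not> (\<exists>J\<in>A. J \<subseteq> I)"

definition critical :: "'a set \<Rightarrow> 'a rel \<Rightarrow> 'a set set \<Rightarrow> 'a set \<Rightarrow> bool" where
  "critical S R A I \<longleftrightarrow> I \<in> intervals S R \<and> avoids A I \<and>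
    (\<forall>K\<in>intervals S R. avoids A K \<and> I \<subseteq> K \<longrightarrow> K = I)"

end

theory Submission
  imports Defs
begin

text \<open>
  A nonempty critical interval \<open>I\<close> that does not exhaust the part of \<open>S\<close> above it has, by local
  finiteness, a largest element \<open>q\<close> and a next element \<open>s\<close>; by maximality the interval
  \<open>I \<union> {s}\<close> contains a member of \<open>A\<close>, which must end in \<open>s\<close>. The same holds below \<open>I\<close> by
  order reversal. Since \<open>A\<close> is an antichain, left and right extremes of its members increase
  together, so a member lying strictly between the two neighbours found this way would be contained
  in \<open>I\<close>.
\<close>

section \<open>Invariance under reversal of the order\<close>

lemma closed_interval_converse: "closed_interval (R\<inverse>) u l = closed_interval R l u"
  by (auto simp: closed_interval_def)

lemma is_successor_converse: "is_successor (R\<inverse>) y x \<longleftrightarrow> is_successor R x y"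
  by (auto simp: is_successor_def)

lemma intervals_converse: "intervals S (R\<inverse>) = intervals S R"
  unfolding intervals_def by blast

lemma finite_intervals_converse: "finite_intervals S (R\<inverse>) = finite_intervals S R"
  by (simp add: finite_intervals_def intervals_converse)

lemma interval_antichains_converse: "interval_antichains S (R\<inverse>) = interval_antichains S R"
  by (simp add: interval_antichains_def finite_intervals_converse)

lemma locally_finite_converse: "locally_finite S (R\<inverse>) \<longleftrightarrow> locally_finite S R"
  unfolding locally_finite_def closed_interval_converse by blast

lemma critical_converse: "critical S (R\<inverse>) A I \<longleftrightarrow> critical S R A I"
  by (simp add: critical_def intervals_converse)

lemma ray_to_pred_converse: "ray_to_pred (R\<inverse>) l = ray_from_succ R l"
  by (simp add: ray_to_pred_def ray_from_succ_def is_successor_converse under_def above_def)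

lemma is_first_converse: "is_first (r\<inverse>) x \<longleftrightarrow> is_last r x"
  by (simp add: is_first_def is_last_def)

locale interval_antichain =
  fixes S :: "'a set" and R :: "'a rel" and A :: "'a set set"
  assumes linear: "linear_order_on S R"
    and locally_finite: "locally_finite S R"
    and antichain: "A \<in> interval_antichains S R"
begin

text \<open>The hypotheses are symmetric under reversal, so a result on the upper side can be
  instantiated at \<open>R\<inverse>\<close> to give its mirror image on the lower side.\<close>

lemma dual: "interval_antichain S (R\<inverse>) A"
  using linear locally_finite antichain
  by (simp add: interval_antichain_def locally_finite_converse interval_antichains_converse)

section \<open>Elementary facts on the order and its gaps\<close>

lemma in_carrier: "(x, y) \<in> R \<Longrightarrow> x \<in> S \<and> y \<in> S"
  using linear
  by (auto simp: linear_order_on_def partial_order_on_def preorder_on_def refl_on_def)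

lemma refl: "x \<in> S \<Longrightarrow> (x, x) \<in> R"
  using linear
  by (auto simp: linear_order_on_def partial_order_on_def preorder_on_def refl_on_def)

lemma trans: "(x, y) \<in> R \<Longrightarrow> (y, z) \<in> R \<Longrightarrow> (x, z) \<in> R"
  using linear
  by (auto simp: linear_order_on_def partial_order_on_def preorder_on_def elim: transE)

lemma antisym: "(x, y) \<in> R \<Longrightarrow> (y, x) \<in> R \<Longrightarrow> x = y"
  using linear
  by (auto simp: linear_order_on_def partial_order_on_def elim: antisymD)

lemma total: "x \<in> S \<Longrightarrow> y \<in> S \<Longrightarrow> (x, y) \<in> R \<or> (y, x) \<in> R"
  using linear refl[of x] by (cases "x = y") (auto simp: linear_order_on_def total_on_def)

lemma member_finite_interval: "J \<in> A \<Longrightarrow> J \<in> finite_intervals S R"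
  using antichain by (auto simp: interval_antichains_def)

lemma member_subset_carrier: "J \<in> A \<Longrightarrow> J \<subseteq> S"
  using member_finite_interval by (auto simp: finite_intervals_def intervals_def)

lemma member_subset_eq: "J \<in> A \<Longrightarrow> K \<in> A \<Longrightarrow> J \<subseteq> K \<Longrightarrow> J = K"
  using antichain by (simp add: interval_antichains_def)

text \<open>Totality turns "nothing lies strictly between" into a dichotomy for all points of
  \<open>S\<close>, the form in which gaps are exploited below.\<close>

lemma is_successor_iff:
  "is_successor R x y \<longleftrightarrow> (x, y) \<in> R \<and> x \<noteq> y \<and> (\<forall>z\<in>S. (z, x) \<in> R \<or> (y, z) \<in> R)"
  unfolding is_successor_def using in_carrier total antisym by metis

lemma is_successor_unique_pred:
  assumes "is_successor R q u" "is_successor R q' u"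
  shows "q' = q"
  using assms in_carrier antisym unfolding is_successor_iff by blast

lemma is_successor_unique_succ:
  assumes "is_successor R l p" "is_successor R l p'"
  shows "p' = p"
  using assms in_carrier antisym unfolding is_successor_iff by blast

lemma ray_to_pred_eq:
  assumes "is_successor R q u"
  shows "ray_to_pred R u = under R q"
proof -
  have "{q'. is_successor R q' u} = {q}"
    using assms is_successor_unique_pred by auto
  then show ?thesis by (simp add: ray_to_pred_def)
qed

lemma interval_succ_pred_eq:
  assumes "is_successor R l p" and "is_successor R q u"
  shows "interval_succ_pred R l u = closed_interval R p q"
proof -
  have "{p. is_successor R l p} = {p}" "{q. is_successor R q u} = {q}"
    using assms is_successor_unique_pred is_successor_unique_succ by auto
  then show ?thesis by (simp add: interval_succ_pred_def)
qed

section \<open>Closed intervals and finite intervals\<close>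

lemma closed_interval_subset_iff:
  assumes "(a, b) \<in> R"
  shows "closed_interval R a b \<subseteq> closed_interval R c d \<longleftrightarrow> (c, a) \<in> R \<and> (b, d) \<in> R"
  using assms in_carrier refl trans unfolding closed_interval_def by blast

lemma closed_interval_nonempty_iff: "closed_interval R a b \<noteq> {} \<longleftrightarrow> (a, b) \<in> R"
  using in_carrier refl trans unfolding closed_interval_def by blast

lemma closed_interval_subset_interval:
  assumes "K \<in> intervals S R" "a \<in> K" "b \<in> K"
  shows "closed_interval R a b \<subseteq> K"
  using assms in_carrier unfolding intervals_def closed_interval_def by blast

lemma finite_has_least:
  assumes "finite X" "X \<noteq> {}" "X \<subseteq> S"
  shows "\<exists>m\<in>X. \<forall>x\<in>X. (m, x) \<in> R"
  using assms
proof (induction X rule: finite_ne_induct)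
  case (singleton x)
  then show ?case using refl by simp
next
  case (insert x X)
  then obtain m where m: "m \<in> X" "\<forall>y\<in>X. (m, y) \<in> R" by auto
  show ?case
  proof (cases "(m, x) \<in> R")
    case True
    with m show ?thesis by blast
  next
    case False
    then have "(x, m) \<in> R" using m total insert.prems by blast
    then have "\<forall>y\<in>insert x X. (x, y) \<in> R" using m trans refl insert.prems by blast
    then show ?thesis by blast
  qed
qed

lemma finite_has_greatest:
  assumes "finite X" "X \<noteq> {}" "X \<subseteq> S"
  shows "\<exists>m\<in>X. \<forall>x\<in>X. (x, m) \<in> R"
  using interval_antichain.finite_has_least[OF dual assms] by simp

text \<open>Finiteness supplies a least and a greatest element, and convexity fills in everything
  between them.\<close>

lemma finite_interval_eq_closed_interval:
  assumes "J \<in> finite_intervals S R" "J \<noteq> {}"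
  obtains a b where "J = closed_interval R a b" "(a, b) \<in> R"
proof -
  have J: "finite J" "J \<subseteq> S" "J \<in> intervals S R"
    using assms unfolding finite_intervals_def intervals_def by blast+
  obtain a where a: "a \<in> J" "\<forall>x\<in>J. (a, x) \<in> R"
    using finite_has_least J assms by blast
  obtain b where b: "b \<in> J" "\<forall>x\<in>J. (x, b) \<in> R"
    using finite_has_greatest J assms by blast
  have "J = closed_interval R a b"
    using a b closed_interval_subset_interval[OF J(3) a(1) b(1)]
    by (auto simp: closed_interval_def)
  then show thesis using that a b by blast
qed

lemma member_cases:
  assumes "J \<in> A"
  obtains "J = {}" | a b where "J = closed_interval R a b" "(a, b) \<in> R"
  using assms member_finite_interval finite_interval_eq_closed_interval by blast

section \<open>Extremes of the members and the order they induce\<close>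

lemma members_nested:
  assumes "closed_interval R a b \<in> A" "closed_interval R c d \<in> A" "(a, b) \<in> R"
    and "(c, a) \<in> R" "(b, d) \<in> R"
  shows "a = c \<and> b = d"
proof -
  have cd: "(c, d) \<in> R" using assms trans by blast
  have "closed_interval R a b = closed_interval R c d"
    using assms member_subset_eq closed_interval_subset_iff by simp
  then have "(a, c) \<in> R" "(d, b) \<in> R"
    using closed_interval_subset_iff[OF cd, of a b] by auto
  then show ?thesis using assms antisym by blast
qed

text \<open>If the left and right extremes disagreed about the order, one member would lie inside
  the other, and the antichain condition would make them equal.\<close>

lemma members_ordered_by_both_extremes:
  assumes "closed_interval R a b \<in> A" "closed_interval R c d \<in> A" "(a, b) \<in> R" "(c, d) \<in> R"
  shows "(a, c) \<in> R \<longleftrightarrow> (b, d) \<in> R"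
  using members_nested[of a b c d] members_nested[of c d a b] assms total in_carrier refl by metis

lemma left_extreme_closed_interval:
  assumes "(a, b) \<in> R"
  shows "left_extreme R (closed_interval R a b) = a"
  unfolding left_extreme_def closed_interval_def
  using assms in_carrier refl antisym by (intro the_equality) blast+

text \<open>The conditions \<open>(a, b) \<in> R\<close> and \<open>(c, d) \<in> R\<close> encode
  nonemptiness, so both sides fail when one of the intervals is empty.\<close>

lemma antichain_order_iff:
  "(closed_interval R a b, closed_interval R c d) \<in> antichain_order R A \<longleftrightarrow>
    closed_interval R a b \<in> A \<and> closed_interval R c d \<in> A \<and>
    (a, b) \<in> R \<and> (c, d) \<in> R \<and> (a, c) \<in> R"
proof (cases "(a, b) \<in> R \<and> (c, d) \<in> R")
  case True
  then show ?thesis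
    using closed_interval_nonempty_iff[of a b] closed_interval_nonempty_iff[of c d]
    by (simp add: antichain_order_def left_extreme_closed_interval)
next
  case False
  then show ?thesis
    using closed_interval_nonempty_iff[of a b] closed_interval_nonempty_iff[of c d]
    by (auto simp: antichain_order_def)
qed

lemma antichain_order_cases:
  assumes "(J, K) \<in> antichain_order R A"
  obtains a b c d where "J = closed_interval R a b" "K = closed_interval R c d"
proof -
  have "J \<in> A" "J \<noteq> {}" "K \<in> A" "K \<noteq> {}"
    using assms by (auto simp: antichain_order_def)
  then show thesis using that member_cases by metis
qed

text \<open>First and last elements are defined relative to the field; reflexivity of
  \<open>R\<close> ensures that it contains every nonempty member.\<close>

lemma Field_antichain_order: "Field (antichain_order R A) = A - {{}}"
proof
  show "Field (antichain_order R A) \<subseteq> A - {{}}"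
    by (auto simp: antichain_order_def Field_def)
  show "A - {{}} \<subseteq> Field (antichain_order R A)"
  proof
    fix J assume J: "J \<in> A - {{}}"
    then obtain a b where "J = closed_interval R a b" "(a, b) \<in> R"
      using member_cases by blast
    then have "(J, J) \<in> antichain_order R A"
      using J antichain_order_iff in_carrier refl by blast
    then show "J \<in> Field (antichain_order R A)" by (rule FieldI1)
  qed
qed

text \<open>Reversal exchanges left and right extremes, and both order the members in the same
  way.\<close>

lemma antichain_order_converse: "antichain_order (R\<inverse>) A = (antichain_order R A)\<inverse>"
proof -
  interpret dual: interval_antichain S "R\<inverse>" A by (rule dual)
  have swap: "(closed_interval R c d, closed_interval R a b) \<in> antichain_order (R\<inverse>) A \<longleftrightarrow>
      (closed_interval R a b, closed_interval R c d) \<in> antichain_order R A" for a b c d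
    using dual.antichain_order_iff[of d c b a] antichain_order_iff[of a b c d]
      members_ordered_by_both_extremes[of a b c d]
    by (auto simp: closed_interval_converse)
  show ?thesis
  proof (intro set_eqI iffI; clarify)
    fix J K assume JK: "(J, K) \<in> antichain_order (R\<inverse>) A"
    then show "(K, J) \<in> antichain_order R A"
      using dual.antichain_order_cases[OF JK] swap by (metis closed_interval_converse)
  next
    fix J K assume "(K, J) \<in> antichain_order R A"
    then show "(J, K) \<in> antichain_order (R\<inverse>) A"
      using antichain_order_cases swap by metis
  qed
qed

text \<open>Every nonempty member is a closed interval, so being first reduces to comparing left
  extremes.\<close>

lemma is_first_closed_interval_iff:
  "is_first (antichain_order R A) (closed_interval R l u) \<longleftrightarrow>
    closed_interval R l u \<in> A \<and> (l, u) \<in> R \<and>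
    (\<forall>a b. closed_interval R a b \<in> A \<and> (a, b) \<in> R \<longrightarrow> (l, a) \<in> R)"
  (is "?L \<longleftrightarrow> ?R")
proof
  assume ?L
  then show ?R
    unfolding is_first_def Field_antichain_order
    using antichain_order_iff closed_interval_nonempty_iff by blast
next
  assume r: ?R
  have "(closed_interval R l u, J) \<in> antichain_order R A" if "J \<in> A - {{}}" for J
  proof -
    have "J \<in> A" "J \<noteq> {}" using that by auto
    then obtain a b where "J = closed_interval R a b" "(a, b) \<in> R"
      using member_cases by blast
    then show ?thesis using that r antichain_order_iff by blast
  qed
  then show ?L
    unfolding is_first_def Field_antichain_order
    using r closed_interval_nonempty_iff by blast
qed

text \<open>The left extreme determines a nonempty member, so consecutive members are those with no
  left extreme strictly between theirs.\<close>

lemma is_successor_closed_interval_iff: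
  "is_successor (antichain_order R A) (closed_interval R l u) (closed_interval R l' u') \<longleftrightarrow>
    closed_interval R l u \<in> A \<and> (l, u) \<in> R \<and> closed_interval R l' u' \<in> A \<and> (l', u') \<in> R \<and>
    (l, l') \<in> R \<and> l \<noteq> l' \<and>
    (\<forall>a b. closed_interval R a b \<in> A \<and> (a, b) \<in> R \<longrightarrow> (a, l) \<in> R \<or> (l', a) \<in> R)"
  (is "?L \<longleftrightarrow> ?R")
proof
  assume L: ?L
  then have 1: "closed_interval R l u \<in> A" "(l, u) \<in> R" "closed_interval R l' u' \<in> A"
      "(l', u') \<in> R" "(l, l') \<in> R"
    unfolding is_successor_def antichain_order_iff by auto
  moreover have "l \<noteq> l'"
  proof
    \<comment> \<open>Equal left extremes force equal right extremes, but a successor is distinct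
      from its predecessor.\<close>
    assume "l = l'"
    then have "u = u'"
      using 1 members_ordered_by_both_extremes[of l u l' u']
        members_ordered_by_both_extremes[of l' u' l u] antisym by blast
    then show False using L \<open>l = l'\<close> unfolding is_successor_def by blast
  qed
  moreover have "(a, l) \<in> R \<or> (l', a) \<in> R" if ab: "closed_interval R a b \<in> A" "(a, b) \<in> R" for a b
  proof (rule ccontr)
    assume n: "\<not> ((a, l) \<in> R \<or> (l', a) \<in> R)"
    then have "(l, a) \<in> R" "(a, l') \<in> R" using 1 ab total in_carrier by blast+
    then have "closed_interval R a b = closed_interval R l u \<or>
        closed_interval R a b = closed_interval R l' u'"
      using L 1 ab unfolding is_successor_def using antichain_order_iff by blast
    then have "a = l \<or> a = l'" using left_extreme_closed_interval 1 ab by metis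
    then show False using n 1 in_carrier refl by blast
  qed
  ultimately show ?R by blast
next
  assume r: ?R
  have "K = closed_interval R l u \<or> K = closed_interval R l' u'"
    if K: "(closed_interval R l u, K) \<in> antichain_order R A"
      "(K, closed_interval R l' u') \<in> antichain_order R A" for K
  proof -
    obtain a b where K_eq: "K = closed_interval R a b" using antichain_order_cases[OF K(2)] by blast
    then have ab: "K \<in> A" "(a, b) \<in> R" "(l, a) \<in> R" "(a, l') \<in> R"
      using K antichain_order_iff by auto
    then have a: "a = l \<or> a = l'" using r K_eq antisym by blast
    have "b = u" if "a = l"
      using members_ordered_by_both_extremes[of a b l u] members_ordered_by_both_extremes[of l u a b]
        that r ab K_eq antisym refl in_carrier by blast
    moreover have "b = u'" if "a = l'"
      using members_ordered_by_both_extremes[of a b l' u']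
        members_ordered_by_both_extremes[of l' u' a b] that r ab K_eq antisym refl in_carrier by blast
    ultimately show ?thesis using a K_eq by blast
  qed
  moreover have "closed_interval R l u \<noteq> closed_interval R l' u'"
    using r left_extreme_closed_interval by metis
  moreover have "(closed_interval R l u, closed_interval R l' u') \<in> antichain_order R A"
    using r antichain_order_iff by simp
  ultimately show ?L unfolding is_successor_def by simp
qed

section \<open>The rays and bounded intervals of the statement are critical\<close>

lemma avoids_iff:
  assumes "{} \<notin> A"
  shows "avoids A K \<longleftrightarrow>
    (\<forall>a b. closed_interval R a b \<in> A \<and> (a, b) \<in> R \<longrightarrow> \<not> closed_interval R a b \<subseteq> K)"
  unfolding avoids_def using assms member_cases by metis

text \<open>The empty set lies inside every set, so an antichain containing it has no nonempty
  member.\<close>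

lemma empty_notin:
  assumes "closed_interval R a b \<in> A" "(a, b) \<in> R"
  shows "{} \<notin> A"
  using assms member_subset_eq[of "{}"] closed_interval_nonempty_iff[of a b] by auto

text \<open>A member inside \<open>I\<close> would be nested in the first element yet end before it;
  a larger interval reaches \<open>u\<close> and thus swallows the first element.\<close>

lemma critical_if_first:
  assumes first: "is_first (antichain_order R A) (closed_interval R l u)"
    and I: "I \<in> intervals S R" "I = ray_to_pred R u" "I \<noteq> {}"
  shows "critical S R A I"
proof -
  have lu: "closed_interval R l u \<in> A" "(l, u) \<in> R"
    and least: "\<And>a b. closed_interval R a b \<in> A \<Longrightarrow> (a, b) \<in> R \<Longrightarrow> (l, a) \<in> R"
    using first unfolding is_first_closed_interval_iff by blast+
  \<comment> \<open>If \<open>u\<close> had no predecessor, the union defining \<open>I\<close>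
    would be empty.\<close>
  obtain q where q: "is_successor R q u" using I by (auto simp: ray_to_pred_def)
  then have I_eq: "I = under R q" using I ray_to_pred_eq by simp
  have qu: "(q, u) \<in> R" "q \<noteq> u" and gap: "\<And>z. z \<in> S \<Longrightarrow> (z, q) \<in> R \<or> (u, z) \<in> R"
    using q unfolding is_successor_iff by blast+
  have "avoids A I"
    unfolding avoids_iff[OF empty_notin[OF lu]]
  proof (intro allI impI notI)
    fix a b assume ab: "closed_interval R a b \<in> A \<and> (a, b) \<in> R" "closed_interval R a b \<subseteq> I"
    then have "(b, q) \<in> R"
      using refl in_carrier by (auto simp: I_eq under_def closed_interval_def)
    then have "b = u" using members_nested[of a b l u] ab lu least trans qu by blast
    then show False using \<open>(b, q) \<in> R\<close> qu antisym by blast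
  qed
  moreover have "K = I" if K: "K \<in> intervals S R" "avoids A K" "I \<subseteq> K" for K
  proof (rule ccontr)
    assume "K \<noteq> I"
    then obtain y where y: "y \<in> K" "y \<notin> I" using K by blast
    have yS: "y \<in> S" using y K by (auto simp: intervals_def)
    then have uy: "(u, y) \<in> R" using gap y by (auto simp: I_eq under_def)
    have "q \<in> K" using K(3) in_carrier qu refl by (auto simp: I_eq under_def)
    then have uK: "u \<in> K"
      using closed_interval_subset_interval[OF K(1) _ y(1)] qu uy by (auto simp: closed_interval_def)
    \<comment> \<open>Either \<open>l\<close> already lies in the ray, or the first element is the
      singleton of \<open>u\<close>.\<close>
    have "l \<in> K"
    proof (cases "(l, q) \<in> R")
      case True
      then show ?thesis using K(3) by (auto simp: I_eq under_def)
    next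
      case False
      then have "l = u" using gap lu in_carrier antisym by blast
      then show ?thesis using uK by simp
    qed
    then show False
      using closed_interval_subset_interval[OF K(1) _ uK] K(2) lu unfolding avoids_def by blast
  qed
  ultimately show ?thesis unfolding critical_def using I by blast
qed

text \<open>The last element is the first one for \<open>R\<inverse>\<close>, with its end points
  swapped.\<close>

lemma critical_if_last:
  assumes "is_last (antichain_order R A) (closed_interval R l u)"
    and "I \<in> intervals S R" "I = ray_from_succ R l" "I \<noteq> {}"
  shows "critical S R A I"
  using interval_antichain.critical_if_first[OF dual, of u l I] assms
  by (simp add: antichain_order_converse closed_interval_converse is_first_converse
      intervals_converse ray_to_pred_converse critical_converse)

text \<open>A member inside \<open>I\<close> starts after \<open>l\<close>, hence not before
  \<open>l'\<close>, and ends before \<open>u'\<close>, so it would be properly nested in the second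
  member. Enlarging \<open>I\<close> downwards captures the first member, upwards the
  second.\<close>

lemma critical_if_successor:
  assumes succ: "is_successor (antichain_order R A) (closed_interval R l u) (closed_interval R l' u')"
    and I: "I \<in> intervals S R" "I = interval_succ_pred R l u'" "I \<noteq> {}"
  shows "critical S R A I"
proof -
  have lu: "closed_interval R l u \<in> A" "(l, u) \<in> R"
    and lu': "closed_interval R l' u' \<in> A" "(l', u') \<in> R"
    and ll: "(l, l') \<in> R" "l \<noteq> l'"
    and between: "\<And>a b. closed_interval R a b \<in> A \<Longrightarrow> (a, b) \<in> R \<Longrightarrow> (a, l) \<in> R \<or> (l', a) \<in> R"
    using succ unfolding is_successor_closed_interval_iff by blast+
  \<comment> \<open>Distinct left extremes make the right extremes distinct too.\<close>
  have uu: "(u, u') \<in> R" "u \<noteq> u'"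
    using members_ordered_by_both_extremes[of l u l' u'] members_ordered_by_both_extremes[of l' u' l u]
      lu lu' ll antisym refl in_carrier by blast+
  obtain p q where p: "is_successor R l p" and q: "is_successor R q u'"
    using I by (auto simp: interval_succ_pred_def)
  then have I_eq: "I = closed_interval R p q" using I interval_succ_pred_eq by simp
  then have pq: "(p, q) \<in> R" using I closed_interval_nonempty_iff by blast
  have lp: "(l, p) \<in> R" "l \<noteq> p" and gapl: "\<And>z. z \<in> S \<Longrightarrow> (z, l) \<in> R \<or> (p, z) \<in> R"
    using p unfolding is_successor_iff by blast+
  have qu: "(q, u') \<in> R" "q \<noteq> u'" and gapu: "\<And>z. z \<in> S \<Longrightarrow> (z, q) \<in> R \<or> (u', z) \<in> R"
    using q unfolding is_successor_iff by blast+
  have "avoids A I"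
    unfolding avoids_iff[OF empty_notin[OF lu]]
  proof (intro allI impI notI)
    fix a b assume ab: "closed_interval R a b \<in> A \<and> (a, b) \<in> R" "closed_interval R a b \<subseteq> I"
    then have pa: "(p, a) \<in> R" and bq: "(b, q) \<in> R"
      using closed_interval_subset_iff by (simp_all add: I_eq)
    then have "(l', a) \<in> R" using between[of a b] ab lp trans antisym by blast
    then have "b = u'" using members_nested[of a b l' u'] ab lu' bq trans qu by blast
    then show False using bq qu antisym by blast
  qed
  moreover have "K = I" if K: "K \<in> intervals S R" "avoids A K" "I \<subseteq> K" for K
  proof (rule ccontr)
    assume "K \<noteq> I"
    then obtain y where y: "y \<in> K" "y \<notin> I" using K by blast
    have yS: "y \<in> S" using y K by (auto simp: intervals_def)
    have pqK: "p \<in> K" "q \<in> K" using K(3) in_carrier pq refl by (auto simp: I_eq closed_interval_def)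
    have "(y, l) \<in> R \<or> (u', y) \<in> R"
      using y gapl[OF yS] gapu[OF yS] by (auto simp: I_eq closed_interval_def)
    then show False
    proof
      assume "(y, l) \<in> R"
      then have "l \<in> K"
        using closed_interval_subset_interval[OF K(1) y(1) pqK(1)] lp by (auto simp: closed_interval_def)
      then have "closed_interval R l q \<subseteq> K"
        using closed_interval_subset_interval[OF K(1)] pqK by blast
      \<comment> \<open>Being strictly below \<open>u'\<close>, the point \<open>u\<close> is at
        most its predecessor \<open>q\<close>.\<close>
      moreover have "(u, q) \<in> R" using gapu uu in_carrier antisym by blast
      moreover have "(l, l) \<in> R" using lu in_carrier refl by blast
      ultimately have "closed_interval R l u \<subseteq> K"
        using closed_interval_subset_iff[OF lu(2), of l q] by blast
      then show False using K(2) lu unfolding avoids_def by blast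
    next
      assume "(u', y) \<in> R"
      then have "u' \<in> K"
        using closed_interval_subset_interval[OF K(1) pqK(2) y(1)] qu by (auto simp: closed_interval_def)
      then have "closed_interval R p u' \<subseteq> K"
        using closed_interval_subset_interval[OF K(1)] pqK by blast
      moreover have "(p, l') \<in> R" using gapl ll in_carrier antisym by blast
      moreover have "(u', u') \<in> R" using lu' in_carrier refl by blast
      ultimately have "closed_interval R l' u' \<subseteq> K"
        using closed_interval_subset_iff[OF lu'(2), of p u'] by blast
      then show False using K(2) lu' unfolding avoids_def by blast
    qed
  qed
  ultimately show ?thesis unfolding critical_def using I by blast
qed

section \<open>Members of the antichain adjacent to a critical interval\<close>

lemma critical_bounded_above:
  assumes crit: "critical S R A I"
    and y: "y \<in> S" "y \<notin> I" "x \<in> I" "(x, y) \<in> R"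
  obtains q s l where "q \<in> I" "\<forall>z\<in>I. (z, q) \<in> R" "is_successor R q s"
    "closed_interval R l s \<in> A" "(l, s) \<in> R" "l \<in> I \<or> l = s"
proof -
  have I: "I \<in> intervals S R" "avoids A I"
    and max: "\<And>K. K \<in> intervals S R \<Longrightarrow> avoids A K \<Longrightarrow> I \<subseteq> K \<Longrightarrow> K = I"
    using crit unfolding critical_def by blast+
  have IS: "I \<subseteq> S" using I by (simp add: intervals_def)
  have fin: "finite (closed_interval R x y)"
    using locally_finite y IS unfolding locally_finite_def by blast
  \<comment> \<open>Otherwise \<open>w\<close> would lie between \<open>x\<close> and
    \<open>z\<close>, and convexity would put it in \<open>I\<close>.\<close>
  have above: "(z, w) \<in> R" if "z \<in> I" "w \<in> closed_interval R x y" "w \<notin> I" for z w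
  proof (rule ccontr)
    assume "(z, w) \<notin> R"
    then have "w \<in> closed_interval R x z"
      using that total IS in_carrier unfolding closed_interval_def by blast
    then show False using closed_interval_subset_interval[OF I(1) y(3) that(1)] that by blast
  qed
  have y_xy: "y \<in> closed_interval R x y" and x_xy: "x \<in> closed_interval R x y"
    using y IS refl by (auto simp: closed_interval_def)
  have sub: "closed_interval R x y \<subseteq> S" using in_carrier by (auto simp: closed_interval_def)
  \<comment> \<open>The window from \<open>x\<close> to \<open>y\<close> is finite and meets both
    \<open>I\<close> (in \<open>x\<close>) and its complement (in \<open>y\<close>), so the boundary
    of \<open>I\<close> can be located inside it.\<close>
  obtain q where q: "q \<in> I \<inter> closed_interval R x y" "\<forall>z\<in>I \<inter> closed_interval R x y. (z, q) \<in> R"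
    using finite_has_greatest[of "I \<inter> closed_interval R x y"] fin x_xy y sub by blast
  obtain s where s: "s \<in> closed_interval R x y - I" "\<forall>z\<in>closed_interval R x y - I. (s, z) \<in> R"
    using finite_has_least[of "closed_interval R x y - I"] fin y_xy y sub by blast
  have q_max: "(z, q) \<in> R" if "z \<in> I" for z
  proof (cases "(x, z) \<in> R")
    case True
    then show ?thesis using q above[OF that y_xy y(2)] that by (auto simp: closed_interval_def)
  next
    case False
    then have "(z, x) \<in> R" using total that IS y by blast
    then show ?thesis using q trans by (auto simp: closed_interval_def)
  qed
  have qs: "(q, s) \<in> R" using above q s by blast
  \<comment> \<open>A point strictly between \<open>q\<close> and \<open>s\<close> would lie in the
    window, contradicting the choice of \<open>q\<close> if it is in \<open>I\<close> and of
    \<open>s\<close> otherwise.\<close>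
  have gap: "(z, q) \<in> R \<or> (s, z) \<in> R" if "z \<in> S" for z
  proof (rule ccontr)
    assume n: "\<not> ((z, q) \<in> R \<or> (s, z) \<in> R)"
    then have "(q, z) \<in> R" "(z, s) \<in> R" using that qs total in_carrier by blast+
    moreover have "(x, q) \<in> R" "(s, y) \<in> R" using q s by (auto simp: closed_interval_def)
    ultimately have "z \<in> closed_interval R x y"
      unfolding closed_interval_def using trans by blast
    then show False using n q s by blast
  qed
  have succ: "is_successor R q s" unfolding is_successor_iff using qs q s gap by blast
  have K: "insert s I \<in> intervals S R"
  proof -
    have "b \<in> insert s I"
      if "a \<in> insert s I" "c \<in> insert s I" "b \<in> S" "(a, b) \<in> R" "(b, c) \<in> R" for a b c
    \<comment> \<open>As \<open>s\<close> is the greatest element of \<open>insert s I\<close>, a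
      point \<open>b\<close> above it equals it; otherwise \<open>a\<close> and \<open>b\<close> are
      at most \<open>q\<close> and convexity of \<open>I\<close> applies.\<close>
    proof (cases "(s, b) \<in> R")
      case True
      have "(c, s) \<in> R" using that q_max qs trans refl s sub by blast
      then have "b = s" using True that trans antisym by blast
      then show ?thesis by simp
    next
      case False
      then have "(b, q) \<in> R" using gap that by blast
      moreover have "a \<noteq> s" using False that by blast
      ultimately show ?thesis
        using closed_interval_subset_interval[OF I(1), of a q] that q by (auto simp: closed_interval_def)
    qed
    then show ?thesis unfolding intervals_def using IS s sub by blast
  qed
  have "\<not> avoids A (insert s I)" using max[OF K] s by blast
  then obtain J where J: "J \<in> A" "J \<subseteq> insert s I" unfolding avoids_def by blast
  \<comment> \<open>Without the new point \<open>s\<close>, the member \<open>J\<close> would lie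
    inside \<open>I\<close>.\<close>
  have sJ: "s \<in> J" using J I(2) unfolding avoids_def by blast
  then obtain a b where ab: "J = closed_interval R a b" "(a, b) \<in> R"
    using member_cases[OF J(1)] by blast
  have abJ: "a \<in> J" "b \<in> J" using ab in_carrier refl by (auto simp: closed_interval_def)
  have "(b, s) \<in> R" using abJ J q_max qs trans refl s sub by blast
  moreover have "(s, b) \<in> R" using sJ ab by (auto simp: closed_interval_def)
  ultimately have "b = s" using antisym by blast
  \<comment> \<open>The left extreme of \<open>J\<close> lies in \<open>insert s I\<close>; this
    later keeps it from falling below the bottom of \<open>I\<close>.\<close>
  then show thesis using that[of q s a] q q_max succ ab J abJ by blast
qed

lemma critical_bounded_below:
  assumes "critical S R A I"
    and "y \<in> S" "y \<notin> I" "x \<in> I" "(y, x) \<in> R"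
  obtains p s u where "p \<in> I" "\<forall>z\<in>I. (p, z) \<in> R" "is_successor R s p"
    "closed_interval R s u \<in> A" "(s, u) \<in> R" "u \<in> I \<or> u = s"
  using interval_antichain.critical_bounded_above[OF dual, of I y x] assms
  by (auto simp: critical_converse is_successor_converse closed_interval_converse)

text \<open>Here \<open>I\<close> is closed downwards, hence the whole ray below \<open>q\<close>. A
  member starting before \<open>l\<close> would end before \<open>s\<close> and so lie in this
  ray.\<close>

lemma critical_bounded_above_only:
  assumes crit: "critical S R A I"
    and y: "y \<in> S" "y \<notin> I" "x \<in> I" "(x, y) \<in> R"
    and unbounded: "\<And>z w. z \<in> S \<Longrightarrow> w \<in> I \<Longrightarrow> (z, w) \<in> R \<Longrightarrow> z \<in> I"
  shows "\<exists>l u. is_first (antichain_order R A) (closed_interval R l u) \<and> I = ray_to_pred R u"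
proof -
  obtain q s l where q: "q \<in> I" "\<forall>z\<in>I. (z, q) \<in> R" "is_successor R q s"
    and l: "closed_interval R l s \<in> A" "(l, s) \<in> R" "l \<in> I \<or> l = s"
    using critical_bounded_above[OF crit y] by blast
  have I_eq: "I = under R q" unfolding under_def using q unbounded in_carrier by blast
  have gap: "\<And>z. z \<in> S \<Longrightarrow> (z, q) \<in> R \<or> (s, z) \<in> R"
    using q(3) unfolding is_successor_iff by blast
  have "(l, a) \<in> R" if ab: "closed_interval R a b \<in> A" "(a, b) \<in> R" for a b
  proof (rule ccontr)
    assume n: "(l, a) \<notin> R"
    then have "(s, b) \<notin> R" using members_ordered_by_both_extremes[OF l(1) ab(1)] l ab by blast
    then have "(b, q) \<in> R" using gap ab in_carrier by blast
    then have "closed_interval R a b \<subseteq> I" using trans by (auto simp: I_eq under_def closed_interval_def)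
    then show False using crit ab unfolding critical_def avoids_def by blast
  qed
  then have "is_first (antichain_order R A) (closed_interval R l s)"
    unfolding is_first_closed_interval_iff using l by blast
  then show ?thesis using I_eq ray_to_pred_eq[OF q(3)] by blast
qed

lemma critical_bounded_below_only:
  assumes "critical S R A I"
    and "y \<in> S" "y \<notin> I" "x \<in> I" "(y, x) \<in> R"
    and "\<And>z w. z \<in> S \<Longrightarrow> w \<in> I \<Longrightarrow> (w, z) \<in> R \<Longrightarrow> z \<in> I"
  shows "\<exists>l u. is_last (antichain_order R A) (closed_interval R l u) \<and> I = ray_from_succ R l"
  using interval_antichain.critical_bounded_above_only[OF dual, of I y x] assms
  by (auto simp: critical_converse antichain_order_converse closed_interval_converse
      is_first_converse ray_to_pred_converse)

text \<open>The member starting just below \<open>I\<close> and the one ending just above it are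
  consecutive: a member strictly between them would start at or after \<open>p\<close> and end at or
  before \<open>q\<close>, hence lie in \<open>I\<close>.\<close>

lemma critical_bounded_both:
  assumes crit: "critical S R A I"
    and y: "y \<in> S" "y \<notin> I" "x \<in> I" "(x, y) \<in> R"
    and y': "y' \<in> S" "y' \<notin> I" "x' \<in> I" "(y', x') \<in> R"
  shows "\<exists>l u l' u'. is_successor (antichain_order R A) (closed_interval R l u) (closed_interval R l' u') \<and>
    I = interval_succ_pred R l u'"
proof -
  obtain q s l' where q: "q \<in> I" "\<forall>z\<in>I. (z, q) \<in> R" "is_successor R q s"
    and l': "closed_interval R l' s \<in> A" "(l', s) \<in> R" "l' \<in> I \<or> l' = s"
    using critical_bounded_above[OF crit y] by blast
  obtain p t u where p: "p \<in> I" "\<forall>z\<in>I. (p, z) \<in> R" "is_successor R t p"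
    and u: "closed_interval R t u \<in> A" "(t, u) \<in> R" "u \<in> I \<or> u = t"
    using critical_bounded_below[OF crit y'] by blast
  have I: "I \<in> intervals S R" "avoids A I" using crit unfolding critical_def by blast+
  have I_eq: "I = closed_interval R p q"
    using p q closed_interval_subset_interval[OF I(1) p(1) q(1)] by (auto simp: closed_interval_def)
  have qs: "(q, s) \<in> R" "q \<noteq> s" and gap_s: "\<And>z. z \<in> S \<Longrightarrow> (z, q) \<in> R \<or> (s, z) \<in> R"
    using q(3) unfolding is_successor_iff by blast+
  have tp: "(t, p) \<in> R" "t \<noteq> p" and gap_t: "\<And>z. z \<in> S \<Longrightarrow> (z, t) \<in> R \<or> (p, z) \<in> R"
    using p(3) unfolding is_successor_iff by blast+
  \<comment> \<open>In both cases for \<open>l'\<close>, in \<open>I\<close> or equal to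
    \<open>s\<close>, it is at least the least element \<open>p\<close> of \<open>I\<close>.\<close>
  have pl': "(p, l') \<in> R" using l' p q qs trans by blast
  have tl': "(t, l') \<in> R" "t \<noteq> l'" using pl' tp trans antisym by blast+
  have "(a, t) \<in> R \<or> (l', a) \<in> R" if ab: "closed_interval R a b \<in> A" "(a, b) \<in> R" for a b
  proof (rule ccontr)
    assume n: "\<not> ((a, t) \<in> R \<or> (l', a) \<in> R)"
    then have "(s, b) \<notin> R" using members_ordered_by_both_extremes[OF l'(1) ab(1)] l' ab by blast
    then have "(b, q) \<in> R" using gap_s ab in_carrier by blast
    moreover have "(p, a) \<in> R" using n gap_t ab in_carrier by blast
    ultimately have "closed_interval R a b \<subseteq> I" using closed_interval_subset_iff ab by (simp add: I_eq)
    then show False using I ab unfolding avoids_def by blast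
  qed
  then have "is_successor (antichain_order R A) (closed_interval R t u) (closed_interval R l' s)"
    unfolding is_successor_closed_interval_iff using l' u tl' by blast
  then show ?thesis using I_eq interval_succ_pred_eq[OF p(3) q(3)] by blast
qed

section \<open>The empty antichain and the empty critical interval\<close>

lemma critical_empty_antichain_iff:
  assumes "A = {}" "I \<in> intervals S R"
  shows "critical S R A I \<longleftrightarrow> I = S"
proof -
  have "S \<in> intervals S R" by (simp add: intervals_def)
  moreover have "K \<subseteq> S" if "K \<in> intervals S R" for K
    using that by (simp add: intervals_def)
  ultimately show ?thesis using assms unfolding critical_def avoids_def by blast
qed

text \<open>If the empty interval is critical, no singleton avoids \<open>A\<close>, so each
  singleton is a member; the antichain condition then excludes all larger members.\<close>

lemma critical_empty_iff: "critical S R A {} \<longleftrightarrow> A = singletons S"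
proof
  assume crit: "critical S R A {}"
  have singleton_in: "{x} \<in> A" if "x \<in> S" for x
  proof -
    have "{x} \<in> intervals S R"
      using that antisym by (auto simp: intervals_def)
    then have "\<not> avoids A {x}" using crit unfolding critical_def by blast
    then obtain J where "J \<in> A" "J \<subseteq> {x}" unfolding avoids_def by blast
    moreover have "J \<noteq> {}" using crit \<open>J \<in> A\<close> unfolding critical_def avoids_def by blast
    ultimately show ?thesis by (auto simp: subset_singleton_iff)
  qed
  moreover have "J \<in> singletons S" if "J \<in> A" for J
  proof -
    have "J \<noteq> {}" using crit that unfolding critical_def avoids_def by blast
    then obtain x where x: "x \<in> J" by blast
    have "x \<in> S" using x that member_subset_carrier by blast
    moreover have "{x} \<subseteq> J" using x by blast
    ultimately have "J = {x}" using singleton_in that member_subset_eq by blast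
    then show ?thesis using \<open>x \<in> S\<close> by (auto simp: singletons_def)
  qed
  ultimately show "A = singletons S" unfolding singletons_def by blast
next
  assume A: "A = singletons S"
  have "K = {}" if "K \<in> intervals S R" "avoids A K" for K
    using that unfolding A avoids_def intervals_def singletons_def by blast
  moreover have "{} \<in> intervals S R" by (simp add: intervals_def)
  moreover have "avoids A {}" unfolding A avoids_def singletons_def by blast
  ultimately show "critical S R A {}" unfolding critical_def by blast
qed

lemma critical_carrier_imp_empty: "critical S R A S \<Longrightarrow> A = {}"
  using member_subset_carrier by (fastforce simp: critical_def avoids_def)

end

theorem theorem17:
  fixes S :: "'a set" and R :: "'a rel" and A :: "'a set set" and I :: "'a set"
  assumes "linear_order_on S R"
    and "locally_finite S R"
    and "A \<in> interval_antichains S R"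
    and "I \<in> intervals S R"
  shows "critical S R A I \<longleftrightarrow>
      (\<exists>l u l' u'. closed_interval R l u \<in> A \<and> closed_interval R l' u' \<in> A \<and>
         is_successor (antichain_order R A) (closed_interval R l u) (closed_interval R l' u') \<and>
         I = interval_succ_pred R l u' \<and> I \<noteq> {})
    \<or> (\<exists>l u. is_first (antichain_order R A) (closed_interval R l u) \<and>
         I = ray_to_pred R u \<and> I \<noteq> {})
    \<or> (\<exists>l u. is_last (antichain_order R A) (closed_interval R l u) \<and>
         I = ray_from_succ R l \<and> I \<noteq> {})
    \<or> (I = S \<and> A = {})
    \<or> (I = {} \<and> A = singletons S)"
proof -
  interpret interval_antichain S R A by unfold_locales (use assms in auto)
  show ?thesis (is "_ \<longleftrightarrow> ?succ \<or> ?first \<or> ?last \<or> ?all \<or> ?empty")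
  proof
    assume crit: "critical S R A I"
    \<comment> \<open>For nonempty \<open>I\<close>, the four combinations of missing points above
      and below correspond to the successor, first, last and whole-order forms.\<close>
    let ?up = "\<exists>y x. y \<in> S \<and> y \<notin> I \<and> x \<in> I \<and> (x, y) \<in> R"
    let ?down = "\<exists>y x. y \<in> S \<and> y \<notin> I \<and> x \<in> I \<and> (y, x) \<in> R"
    consider "I = {}" | "I \<noteq> {}" ?up ?down | "I \<noteq> {}" ?up "\<not> ?down"
      | "I \<noteq> {}" "\<not> ?up" ?down | "I \<noteq> {}" "\<not> ?up" "\<not> ?down" by blast
    then show "?succ \<or> ?first \<or> ?last \<or> ?all \<or> ?empty"
    proof cases
      case 1
      then show ?thesis using crit critical_empty_iff by blast
    next
      case 2
      then have "\<exists>l u l' u'. is_successor (antichain_order R A) (closed_interval R l u)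
          (closed_interval R l' u') \<and> I = interval_succ_pred R l u'"
        using critical_bounded_both[OF crit] by blast
      then have ?succ using 2(1) is_successor_closed_interval_iff by blast
      then show ?thesis by (rule disjI1)
    next
      case 3
      then have ?first using critical_bounded_above_only[OF crit] by blast
      then show ?thesis by blast
    next
      case 4
      then have ?last using critical_bounded_below_only[OF crit] by blast
      then show ?thesis by blast
    next
      case 5
      \<comment> \<open>By totality a point outside \<open>I\<close> is above or below some point of
        \<open>I\<close>, so it would witness \<open>?up\<close> or \<open>?down\<close>.\<close>
      then have "I = S" using total assms(4) unfolding intervals_def by blast
      then show ?thesis using crit critical_carrier_imp_empty by blast
    qed
  next
    assume "?succ \<or> ?first \<or> ?last \<or> ?all \<or> ?empty"
    then show "critical S R A I"
    proof (elim disjE exE conjE)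
      assume "I = S" "A = {}"
      then show ?thesis using critical_empty_antichain_iff assms(4) by simp
    next
      assume "I = {}" "A = singletons S"
      then show ?thesis using critical_empty_iff by simp
    qed (use critical_if_successor critical_if_first critical_if_last assms(4) in metis)+
  qed
qed

end
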